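(* Let $I$ be a positive integer and let $\mathbf{P}=(p_{ij})\in\mathcal{S}^{I^2}$ be an $I\times I$ probability table with decomposition $\mathbf{P}=\mathbf{P}_{\mathrm{ind}}\oplus\mathbf{P}_{\mathrm{int}}$ into its independent and interaction components. Then $\mathbf{P}$ is a quasi-symmetric probability table, i.e. $\mathbf{P}_{\mathrm{int}}=T(\mathbf{P}_{\mathrm{int}})$, if and only if its local odds ratios are symmetric, i.e. $\theta_{ij}=\theta_{ji}$ for all $i,j\in\{1,\ldots,I-1\}$, where $$\theta_{ij}=\frac{p_{ij}\,p_{i+1,j+1}}{p_{i,j+1}\,p_{i+1,j}}.$$
   Context: $\mathcal{S}^{I^2}$ is the set of all $I\times I$ tables $\mathbf{P}=(p_{ij})$ of real numbers with $p_{ij}>0$ and $\sum_{i,j=1}^{I}p_{ij}=1$ (probability tables). For a table $\mathbf{R}=(r_{ij})$ with positive entries, the closure is $\mathcal{C}\mathbf{R}=\big(r_{ij}/\sum_{k,l}r_{kl}\big)_{ij}$. Perturbation: $\mathbf{P}\oplus\mathbf{Q}=\mathcal{C}(p_{ij}q_{ij})$; powering by $\alpha\in\mathbb{R}$: $\alpha\odot\mathbf{P}=\mathcal{C}(p_{ij}^{\alpha})$; $\mathbf{P}\ominus\mathbf{Q}=\mathbf{P}\oplus((-1)\odot\mathbf{Q})$. With $\oplus$ as addition and $\odot$ as scalar multiplication $\mathcal{S}^{I^2}$ is a real vector space of dimension $I^2-1$. $T(\mathbf{P})$ denotes the transposed table, with $(i,j)$ entry $p_{ji}$. Let $g(row_i[\mathbf{P}])=\big(\prod_{j=1}^{I}p_{ij}\big)^{1/I}$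 and $g(col_j[\mathbf{P}])=\big(\prod_{i=1}^{I}p_{ij}\big)^{1/I}$ be the geometric means of the $i$-th row and $j$-th column. Let $row(\mathbf{P})$ be the closure of the table whose $(i,j)$ entry is $g(row_i[\mathbf{P}])$, and $col(\mathbf{P})$ the closure of the table whose $(i,j)$ entry is $g(col_j[\mathbf{P}])$. The independent component is $\mathbf{P}_{\mathrm{ind}}=row(\mathbf{P})\oplus col(\mathbf{P})$ and the interaction component is $\mathbf{P}_{\mathrm{int}}=\mathbf{P}\ominus\mathbf{P}_{\mathrm{ind}}$, so $\mathbf{P}=\mathbf{P}_{\mathrm{ind}}\oplus\mathbf{P}_{\mathrm{int}}$. *)

theory Defs
  imports Complex_Main "Jordan_Normal_Form.Matrix"
begin

text \<open>An \<open>I \<times> I\<close> table is an element of \<^term>\<open>carrier_mat I I\<close>. Matrix indices start at 0, so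
  the entry \<open>p_ij\<close> with \<open>1 \<le> i, j \<le> I\<close> is \<^term>\<open>P $$ (i - 1, j - 1)\<close>.\<close>

definition prob_tables :: "nat \<Rightarrow> real mat set" where
  "prob_tables I = {P \<in> carrier_mat I I.
     (\<forall>i<I. \<forall>j<I. P $$ (i, j) > 0) \<and> (\<Sum>i<I. \<Sum>j<I. P $$ (i, j)) = 1}"

definition closure_table :: "real mat \<Rightarrow> real mat" where
  "closure_table R = mat (dim_row R) (dim_col R)
     (\<lambda>(i, j). R $$ (i, j) / (\<Sum>k<dim_row R. \<Sum>l<dim_col R. R $$ (k, l)))"

definition perturb :: "real mat \<Rightarrow> real mat \<Rightarrow> real mat" where
  "perturb P Q = closure_table (mat (dim_row P) (dim_col P) (\<lambda>(i, j). P $$ (i, j) * Q $$ (i, j)))"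

definition powering :: "real \<Rightarrow> real mat \<Rightarrow> real mat" where
  "powering a P = closure_table (mat (dim_row P) (dim_col P) (\<lambda>(i, j). P $$ (i, j) powr a))"

definition perturb_diff :: "real mat \<Rightarrow> real mat \<Rightarrow> real mat" where
  "perturb_diff P Q = perturb P (powering (- 1) Q)"

definition row_gmean :: "real mat \<Rightarrow> nat \<Rightarrow> real" where
  "row_gmean P i = root (dim_col P) (\<Prod>j<dim_col P. P $$ (i, j))"

definition col_gmean :: "real mat \<Rightarrow> nat \<Rightarrow> real" where
  "col_gmean P j = root (dim_row P) (\<Prod>i<dim_row P. P $$ (i, j))"

definition row_table :: "real mat \<Rightarrow> real mat" where
  "row_table P = closure_table (mat (dim_row P) (dim_col P) (\<lambda>(i, j). row_gmean P i))"

definition col_table :: "real mat \<Rightarrow> real mat" where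
  "col_table P = closure_table (mat (dim_row P) (dim_col P) (\<lambda>(i, j). col_gmean P j))"

definition ind_component :: "real mat \<Rightarrow> real mat" where
  "ind_component P = perturb (row_table P) (col_table P)"

definition int_component :: "real mat \<Rightarrow> real mat" where
  "int_component P = perturb_diff P (ind_component P)"

definition quasi_symmetric :: "real mat \<Rightarrow> bool" where
  "quasi_symmetric P \<longleftrightarrow> int_component P = transpose_mat (int_component P)"

definition local_odds_ratio :: "real mat \<Rightarrow> nat \<Rightarrow> nat \<Rightarrow> real" where
  "local_odds_ratio P i j =
     (P $$ (i, j) * P $$ (i + 1, j + 1)) / (P $$ (i, j + 1) * P $$ (i + 1, j))"

end

theory Submission
  imports Defs
begin

text \<open>Up to a constant factor, the interaction component has entries \<open>p_ij / (r_i c_j)\<close> with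
  \<open>r_i\<close>, \<open>c_j\<close> the row and column geometric means. Hence it has the same local odds ratios as \<open>P\<close>,
  which gives one direction. Conversely, let \<open>d_ij\<close> be the quotient of its \<open>(i, j)\<close> and \<open>(j, i)\<close>
  entries. If the odds ratios are symmetric, then those of \<open>d\<close> are all 1, so \<open>d_ij = d_i0 d_0j\<close>. The
  row products of the interaction component do not depend on the row, nor its column products on
  the column; so neither do the row products of \<open>d\<close>. This forces \<open>d_i0 ^ I = 1\<close>, and \<open>d\<close> is
  constantly 1.\<close>

text \<open>Normalising constants cancel in every odds ratio, so this and the next scaling lemmas
  hide them behind one positive factor common to all entries.\<close>

lemma closure_table_scaling:
  assumes "n > 0" "R \<in> carrier_mat n n" "\<And>i j. i < n \<Longrightarrow> j < n \<Longrightarrow> R $$ (i, j) > 0"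
  obtains c where "c > 0" "\<And>i j. i < n \<Longrightarrow> j < n \<Longrightarrow> closure_table R $$ (i, j) = c * R $$ (i, j)"
proof -
  define s where "s = (\<Sum>k<n. \<Sum>l<n. R $$ (k, l))"
  have "s > 0"
    unfolding s_def using assms by (intro sum_pos) auto
  moreover have "closure_table R $$ (i, j) = inverse s * R $$ (i, j)" if "i < n" "j < n" for i j
    using that assms(2) by (auto simp: closure_table_def s_def divide_inverse)
  ultimately show thesis
    using that[of "inverse s"] by simp
qed

lemma perturb_carrier: "P \<in> carrier_mat m n \<Longrightarrow> perturb P Q \<in> carrier_mat m n"
  by (auto simp: perturb_def closure_table_def)

lemma perturb_scaling:
  assumes "n > 0" "P \<in> carrier_mat n n"
    and "\<And>i j. i < n \<Longrightarrow> j < n \<Longrightarrow> P $$ (i, j) > 0" "\<And>i j. i < n \<Longrightarrow> j < n \<Longrightarrow> Q $$ (i, j) > 0"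
  obtains c where "c > 0"
    "\<And>i j. i < n \<Longrightarrow> j < n \<Longrightarrow> perturb P Q $$ (i, j) = c * (P $$ (i, j) * Q $$ (i, j))"
proof -
  let ?R = "mat n n (\<lambda>(i, j). P $$ (i, j) * Q $$ (i, j))"
  have "perturb P Q = closure_table ?R"
    using assms(2) by (auto simp: perturb_def)
  moreover obtain c where "c > 0"
    "\<And>i j. i < n \<Longrightarrow> j < n \<Longrightarrow> closure_table ?R $$ (i, j) = c * ?R $$ (i, j)"
    by (rule closure_table_scaling[of n ?R]) (use assms in auto)
  ultimately show thesis
    using that by simp
qed

lemma powering_minus_one_scaling:
  assumes "n > 0" "P \<in> carrier_mat n n" "\<And>i j. i < n \<Longrightarrow> j < n \<Longrightarrow> P $$ (i, j) > 0"
  obtains c where "c > 0"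
    "\<And>i j. i < n \<Longrightarrow> j < n \<Longrightarrow> powering (- 1) P $$ (i, j) = c / P $$ (i, j)"
proof -
  let ?R = "mat n n (\<lambda>(i, j). P $$ (i, j) powr - 1)"
  obtain c where "c > 0" and
    c: "\<And>i j. i < n \<Longrightarrow> j < n \<Longrightarrow> closure_table ?R $$ (i, j) = c * ?R $$ (i, j)"
    by (rule closure_table_scaling[of n ?R]) (use assms in \<open>auto simp: less_imp_neq[symmetric]\<close>)
  moreover have "powering (- 1) P $$ (i, j) = c / P $$ (i, j)" if "i < n" "j < n" for i j
    using c[OF that] assms(2) assms(3)[OF that] that
    by (auto simp: powering_def powr_minus divide_inverse)
  ultimately show thesis
    using that by blast
qed

lemma int_component_scaling:
  assumes n: "n > 0" and P: "P \<in> carrier_mat n n"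
    and pos: "\<And>i j. i < n \<Longrightarrow> j < n \<Longrightarrow> P $$ (i, j) > 0"
  obtains c where "c > 0"
    "\<And>i j. i < n \<Longrightarrow> j < n \<Longrightarrow>
      int_component P $$ (i, j) = c * P $$ (i, j) / (row_gmean P i * col_gmean P j)"
proof -
  have r: "row_gmean P i > 0" if "i < n" for i
    using that n P pos by (auto simp: row_gmean_def intro!: prod_pos)
  have c: "col_gmean P j > 0" if "j < n" for j
    using that n P pos by (auto simp: col_gmean_def intro!: prod_pos)
  obtain a where a: "a > 0" and
    "\<And>i j. i < n \<Longrightarrow> j < n \<Longrightarrow>
      closure_table (mat n n (\<lambda>(i, j). row_gmean P i)) $$ (i, j) =
      a * mat n n (\<lambda>(i, j). row_gmean P i) $$ (i, j)"
    by (rule closure_table_scaling[of n "mat n n (\<lambda>(i, j). row_gmean P i)"]) (use n r in auto)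
  then have ra: "row_table P $$ (i, j) = a * row_gmean P i" if "i < n" "j < n" for i j
    using that P by (simp add: row_table_def)
  obtain b where b: "b > 0" and
    "\<And>i j. i < n \<Longrightarrow> j < n \<Longrightarrow>
      closure_table (mat n n (\<lambda>(i, j). col_gmean P j)) $$ (i, j) =
      b * mat n n (\<lambda>(i, j). col_gmean P j) $$ (i, j)"
    by (rule closure_table_scaling[of n "mat n n (\<lambda>(i, j). col_gmean P j)"]) (use n c in auto)
  then have cb: "col_table P $$ (i, j) = b * col_gmean P j" if "i < n" "j < n" for i j
    using that P by (simp add: col_table_def)
  have row_carrier: "row_table P \<in> carrier_mat n n"
    using P by (auto simp: row_table_def closure_table_def)
  then have ind: "ind_component P \<in> carrier_mat n n"
    by (simp add: ind_component_def perturb_carrier)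
  obtain d where d: "d > 0" and
    "\<And>i j. i < n \<Longrightarrow> j < n \<Longrightarrow> perturb (row_table P) (col_table P) $$ (i, j) =
      d * (row_table P $$ (i, j) * col_table P $$ (i, j))"
    by (rule perturb_scaling[of n "row_table P" "col_table P"])
      (use n row_carrier a b r c ra cb in auto)
  then have di: "ind_component P $$ (i, j) = d * (a * row_gmean P i * (b * col_gmean P j))"
    if "i < n" "j < n" for i j
    using that ra cb by (simp add: ind_component_def)
  have ipos: "ind_component P $$ (i, j) > 0" if "i < n" "j < n" for i j
    using that a b d r c di by simp
  obtain e where e: "e > 0" and
    ei: "\<And>i j. i < n \<Longrightarrow> j < n \<Longrightarrow>
      powering (- 1) (ind_component P) $$ (i, j) = e / ind_component P $$ (i, j)"
    using powering_minus_one_scaling[OF n ind ipos] by blast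
  obtain f where f: "f > 0" and
    fi: "\<And>i j. i < n \<Longrightarrow> j < n \<Longrightarrow> int_component P $$ (i, j) =
      f * (P $$ (i, j) * powering (- 1) (ind_component P) $$ (i, j))"
    unfolding int_component_def perturb_diff_def
    by (rule perturb_scaling[of n P "powering (- 1) (ind_component P)"])
      (use n P pos ei e ipos in auto)
  show thesis
  proof
    \<comment> \<open>\<open>a\<close>, \<open>b\<close> and \<open>d\<close> normalise the row
      table, the column table and their perturbation; they end up in the denominator because the
      independent component is inverted. \<open>e\<close> and \<open>f\<close> come from that
      inversion and the final perturbation.\<close>
    show "f * e / (d * a * b) > 0"
      using a b d e f by simp
    show "int_component P $$ (i, j) =
        f * e / (d * a * b) * P $$ (i, j) / (row_gmean P i * col_gmean P j)"
      if "i < n" "j < n" for i j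
      using that by (simp add: fi ei di mult_ac)
  qed
qed

text \<open>Vanishing 2 x 2 minors on neighbouring rows and columns can be chained: two minors
  sharing a column (or row) combine into a wider one after cancelling a nonzero shared entry.
  Chaining first along columns, then along rows, reaches the minors through row 0 and column
  0.\<close>

lemma cross_ratio_from_local:
  fixes d :: "nat \<Rightarrow> nat \<Rightarrow> 'a::field"
  assumes nz: "\<And>i j. i < m \<Longrightarrow> j < n \<Longrightarrow> d i j \<noteq> 0"
    and loc: "\<And>i j. Suc i < m \<Longrightarrow> Suc j < n \<Longrightarrow>
      d i j * d (Suc i) (Suc j) = d i (Suc j) * d (Suc i) j"
    and ij: "i < m" "j < n"
  shows "d i j * d 0 0 = d i 0 * d 0 j"
proof -
  \<comment> \<open>Rows stay adjacent while the columns spread from 0 to \<open>j\<close>; the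
    entry cancelled is \<open>d i j\<close>.\<close>
  have adj: "d i j * d (Suc i) 0 = d (Suc i) j * d i 0" if "Suc i < m" "j < n" for i j
    using that(2)
  proof (induction j)
    case (Suc j)
    have "d i j * (d i (Suc j) * d (Suc i) 0) = d i (Suc j) * (d i j * d (Suc i) 0)"
      by (simp only: mult_ac)
    also have "\<dots> = d i (Suc j) * d (Suc i) j * d i 0"
      using Suc.IH[OF Suc_lessD[OF Suc.prems]] by (simp only: mult.assoc)
    also have "\<dots> = d i j * (d (Suc i) (Suc j) * d i 0)"
      by (simp only: loc[OF that(1) Suc.prems, symmetric] mult.assoc)
    finally have "d i j * (d i (Suc j) * d (Suc i) 0) = d i j * (d (Suc i) (Suc j) * d i 0)" .
    with nz[of i j] that(1) Suc.prems show ?case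
      by simp
  qed simp
  \<comment> \<open>Now column \<open>j\<close> is fixed and the rows spread, with
    \<open>adj\<close> as the link between consecutive rows; the entry cancelled is
    \<open>d i 0\<close>.\<close>
  show ?thesis
    using ij(1)
  proof (induction i)
    case (Suc i)
    have "d i 0 * (d (Suc i) j * d 0 0) = d (Suc i) j * d i 0 * d 0 0"
      by (simp only: mult_ac)
    also have "\<dots> = d (Suc i) 0 * (d i j * d 0 0)"
      unfolding adj[OF Suc.prems ij(2), symmetric] by (simp only: mult_ac)
    also have "\<dots> = d i 0 * (d (Suc i) 0 * d 0 j)"
      unfolding Suc.IH[OF Suc_lessD[OF Suc.prems]] by (simp only: mult_ac)
    finally have "d i 0 * (d (Suc i) j * d 0 0) = d i 0 * (d (Suc i) 0 * d 0 j)" .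
    with nz[of i 0] ij(2) Suc.prems show ?case
      by simp
  qed simp
qed

text \<open>\<open>x\<close> and its transpose have the same odds ratios, so their quotient
  \<open>d\<close> is a row factor times a column factor; the constant margins force both factors to
  be 1.\<close>

lemma symmetric_if_constant_margins:
  fixes x :: "nat \<Rightarrow> nat \<Rightarrow> real"
  assumes pos: "\<And>i j. i < n \<Longrightarrow> j < n \<Longrightarrow> x i j > 0"
    and row: "\<And>i. i < n \<Longrightarrow> (\<Prod>j<n. x i j) = A"
    and col: "\<And>j. j < n \<Longrightarrow> (\<Prod>i<n. x i j) = B"
    and loc: "\<And>i j. Suc i < n \<Longrightarrow> Suc j < n \<Longrightarrow>
      x i j * x (Suc i) (Suc j) / (x i (Suc j) * x (Suc i) j) =
      x j i * x (Suc j) (Suc i) / (x j (Suc i) * x (Suc j) i)"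
    and ij: "i < n" "j < n"
  shows "x i j = x j i"
proof -
  define d where "d = (\<lambda>i j. x i j / x j i)"
  have d_pos: "d i j > 0" if "i < n" "j < n" for i j
    using that pos by (simp add: d_def)
  have d00: "d 0 0 = 1"
    using ij pos[of 0 0] by (simp add: d_def)
  have split: "d i j = d i 0 * d 0 j" if "i < n" "j < n" for i j
  proof -
    \<comment> \<open>The odds ratio of \<open>d\<close> is that of \<open>x\<close> at
      \<open>(i, j)\<close> divided by that at \<open>(j, i)\<close>, hence 1.\<close>
    have "d i j * d (Suc i) (Suc j) = d i (Suc j) * d (Suc i) j" if "Suc i < n" "Suc j < n" for i j
      using loc[OF that] that pos[of i j] pos[of "Suc i" "Suc j"] pos[of i "Suc j"]
        pos[of "Suc i" j] pos[of j i] pos[of "Suc j" "Suc i"] pos[of j "Suc i"] pos[of "Suc j" i]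
      by (simp add: d_def field_simps)
    then have "d i j * d 0 0 = d i 0 * d 0 j"
      using that d_pos by (intro cross_ratio_from_local[of n n]) (auto simp: less_imp_neq[symmetric])
    then show ?thesis
      by (simp add: d00)
  qed
  \<comment> \<open>Row \<open>i\<close> of \<open>d\<close> is row \<open>i\<close> of
    \<open>x\<close> divided entrywise by column \<open>i\<close> of \<open>x\<close>.\<close>
  have margin: "(\<Prod>j<n. d i j) = A / B" if "i < n" for i
    using that by (simp add: d_def prod_dividef row col)
  \<comment> \<open>By \<open>split\<close>, row \<open>i\<close> of \<open>d\<close> is
    \<open>d i 0\<close> times row 0. Both rows have the same nonzero product, so
    \<open>d i 0\<close> is a positive \<open>n\<close>-th root of 1.\<close>
  have d_col: "d i 0 = 1" if "i < n" for i
  proof -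
    have "A / B = (\<Prod>j<n. d i 0 * d 0 j)"
      unfolding margin[OF that, symmetric] using that by (intro prod.cong refl split) auto
    also have "\<dots> = d i 0 ^ n * (A / B)"
      using that margin[of 0] by (simp add: prod.distrib)
    finally have "A / B = d i 0 ^ n * (A / B)" .
    moreover have "A / B > 0"
      unfolding margin[OF that, symmetric] using that d_pos by (intro prod_pos) auto
    ultimately have "d i 0 ^ n = 1"
      by (metis less_irrefl mult_cancel_right1)
    then show ?thesis
      using that d_pos[of i 0] power_eq_iff_eq_base[of n "d i 0" 1] by simp
  qed
  \<comment> \<open>The factor \<open>d 0 j\<close> is also 1, being the inverse of
    \<open>d j 0\<close>.\<close>
  have "d i j = 1"
    using ij split[of i j] split[of j 0] split[of 0 j] d_col[of i] d_col[of j] pos[of 0 j] pos[of j 0]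
    by (auto simp: d_def)
  then show ?thesis
    using ij pos[of j i] by (simp add: d_def)
qed

theorem theorem2:
  fixes I :: nat and P :: "real mat"
  assumes "I > 0" and "P \<in> prob_tables I"
  shows "quasi_symmetric P \<longleftrightarrow>
    (\<forall>i<I - 1. \<forall>j<I - 1. local_odds_ratio P i j = local_odds_ratio P j i)"
proof -
  have P: "P \<in> carrier_mat I I" and pos: "\<And>i j. i < I \<Longrightarrow> j < I \<Longrightarrow> P $$ (i, j) > 0"
    using assms(2) by (auto simp: prob_tables_def)
  define r where "r = row_gmean P"
  define c where "c = col_gmean P"
  define x where "x = (\<lambda>i j. int_component P $$ (i, j))"
  have r_pos: "r i > 0" and r_pow: "r i ^ I = (\<Prod>j<I. P $$ (i, j))" if "i < I" for i
    using that assms(1) P pos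
    by (auto simp: r_def row_gmean_def intro!: prod_pos real_root_pow_pos2 prod_nonneg less_imp_le)
  have c_pos: "c j > 0" and c_pow: "c j ^ I = (\<Prod>i<I. P $$ (i, j))" if "j < I" for j
    using that assms(1) P pos
    by (auto simp: c_def col_gmean_def intro!: prod_pos real_root_pow_pos2 prod_nonneg less_imp_le)
  obtain k where k: "k > 0"
    and x_eq: "\<And>i j. i < I \<Longrightarrow> j < I \<Longrightarrow> x i j = k * P $$ (i, j) / (r i * c j)"
    using int_component_scaling[OF assms(1) P pos] unfolding x_def r_def c_def by blast
  have x_pos: "x i j > 0" if "i < I" "j < I" for i j
    using that k pos r_pos c_pos by (simp add: x_eq)
  \<comment> \<open>The factor \<open>r i\<close> occurs \<open>I\<close> times in the denominator,
    and \<open>r i ^ I\<close> is exactly the product of row \<open>i\<close> of \<open>P\<close>,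
    so all dependence on \<open>i\<close> cancels.\<close>
  have row: "(\<Prod>j<I. x i j) = k ^ I / (\<Prod>j<I. c j)" if "i < I" for i
    using that r_pos[OF that]
    by (simp add: x_eq prod_dividef prod.distrib flip: r_pow)
  have col: "(\<Prod>i<I. x i j) = k ^ I / (\<Prod>i<I. r i)" if "j < I" for j
    using that c_pos[OF that]
    by (simp add: x_eq prod_dividef prod.distrib flip: c_pow)
  \<comment> \<open>Each of the two row means and two column means involved occurs once above and
    once below the fraction bar, and \<open>k\<close> twice in both.\<close>
  have odds: "local_odds_ratio P i j =
      x i j * x (Suc i) (Suc j) / (x i (Suc j) * x (Suc i) j)" if "Suc i < I" "Suc j < I" for i j
    using that k r_pos[of i] r_pos[of "Suc i"] c_pos[of j] c_pos[of "Suc j"]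
    by (simp add: x_eq local_odds_ratio_def)
  have "int_component P \<in> carrier_mat I I"
    using P by (simp add: int_component_def perturb_diff_def perturb_carrier)
  then have qs: "quasi_symmetric P \<longleftrightarrow> (\<forall>i<I. \<forall>j<I. x i j = x j i)"
    by (auto simp: quasi_symmetric_def mat_eq_iff x_def)
  show ?thesis
  proof
    assume "quasi_symmetric P"
    then have sym: "x i j = x j i" if "i < I" "j < I" for i j
      using that qs by blast
    show "\<forall>i<I - 1. \<forall>j<I - 1. local_odds_ratio P i j = local_odds_ratio P j i"
    proof (intro allI impI)
      fix i j assume "i < I - 1" "j < I - 1"
      \<comment> \<open>Transposing keeps the two diagonal entries of the 2 x 2 block and swaps the
        two factors of the denominator.\<close>
      then show "local_odds_ratio P i j = local_odds_ratio P j i"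
        using sym[of i j] sym[of "Suc i" "Suc j"] sym[of i "Suc j"] sym[of "Suc i" j]
        by (simp add: odds mult.commute)
    qed
  next
    assume loc: "\<forall>i<I - 1. \<forall>j<I - 1. local_odds_ratio P i j = local_odds_ratio P j i"
    have "x i j = x j i" if "i < I" "j < I" for i j
      \<comment> \<open>The margins \<open>row\<close> and \<open>col\<close> fix the constants
        \<open>A\<close> and \<open>B\<close>; the placeholder leaves the odds-ratio premise as the
        only goal.\<close>
      using x_pos row col _ that
    proof (rule symmetric_if_constant_margins)
      fix i j assume "Suc i < I" "Suc j < I"
      then show "x i j * x (Suc i) (Suc j) / (x i (Suc j) * x (Suc i) j) =
          x j i * x (Suc j) (Suc i) / (x j (Suc i) * x (Suc j) i)"
        using loc odds[of i j] odds[of j i] by (metis Suc_lessE diff_Suc_1)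
    qed
    then show "quasi_symmetric P"
      using qs by blast
  qed
qed

end
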